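(* Let $n\ge2$, $0<p,q<\infty$, $0<s<1$ with $sp\ge n$. Then there exists a bounded continuous function $u:\mathbb{R}^n\to\mathbb{R}$ in $\dot{W}^{s,p}_q(\mathbb{R}^n)$ such that there exists no curve (continuous map) $\gamma:[0,\infty)\to\mathbb{R}^n$ with $\gamma(0)=0$ and $\lim_{t\to\infty}\gamma(t)=\infty$ (i.e. $|\gamma(t)|\to\infty$) for which the limit $\lim_{t\to\infty}u(\gamma(t))$ exists.
   Context: $u\in\dot{W}^{s,p}_q(\mathbb{R}^n)$ means that $u:\mathbb{R}^n\to\mathbb{R}$ is measurable and $\int_{\mathbb{R}^n}\Big(\int_{\mathbb{R}^n}\frac{|u(x)-u(y)|^q}{|x-y|^{n+sq}}\,dy\Big)^{p/q}dx<\infty$. *)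

theory Defs
  imports "HOL-Analysis.Analysis"
begin

(* Real power of an extended nonnegative real, with the usual convention
   \<infinity>^r = \<infinity>; intended for exponents r > 0. *)
definition ennreal_powr :: "ennreal \<Rightarrow> real \<Rightarrow> ennreal" where
  "ennreal_powr a r = (if a = \<infinity> then \<infinity> else ennreal (enn2real a powr r))"

(* The homogeneous fractional space of exponents s, p, q on R^n, where n = CARD('n).
   On the diagonal x = y, a null set in y, the integrand is 0 / 0 = 0. *)
definition W_dot :: "real \<Rightarrow> real \<Rightarrow> real \<Rightarrow> (real ^ 'n \<Rightarrow> real) set" where
  "W_dot s p q =
     {u \<in> borel_measurable lebesgue.
        (\<integral>\<^sup>+ x. ennreal_powr
           (\<integral>\<^sup>+ y. ennreal (\<bar>u x - u y\<bar> powr q / norm (x - y) powr (real CARD('n) + s * q))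
              \<partial>lebesgue)
           (p / q) \<partial>lebesgue) < \<infinity>}"

end

theory Submission
  imports Defs
begin

text \<open>
  The function is radial: $u(x) = \sin (\ln (\ln R(x)))$ with $R(x) = e + |x|$. Along a
  curve that tends to infinity, $|\gamma(t)|$ takes all large values by the intermediate value
  theorem, so $u$ attains both $0$ and $1$ at arbitrarily late times and has no limit
  (\<open>slow_wave_no_limit_along_curve\<close>).

  The seminorm is finite because the iterated logarithm oscillates slowly. On the scale $R(x)$ around
  $x$ the function varies by about $1 / \ln R(x)$; more precisely, with $d = |\ln R(x) - \ln R(y)|$,
  the difference $|u(x) - u(y)|$ is at most $(d + d^2) / \ln R(x)$ (\<open>slow_wave_diff_le\<close>). The
  numerator depends only on the ratio $R(y) / R(x)$ and is at most a multiple of any positive power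
  of the larger of this ratio and its inverse. Comparing with powers of $|x - y|$ and of $|y|$
  (\<open>slow_wave_quotient_le\<close>) and integrating in $y$ therefore gives the bound that scaling
  predicts,
  \[ \int \frac{|u(x) - u(y)|^q}{|x - y|^{n + sq}} \, dy \le C R(x)^{-sq} (\ln R(x))^{-q} \]
  (\<open>slow_wave_inner_integral_le\<close>). The power $p/q$ of the right-hand side is a multiple of
  $R^{-sp} (\ln R)^{-p}$, which is at most $R^{-n} (\ln R)^{-p}$ since $sp \ge n$. This is
  integrable (\<open>nn_integral_log_critical_power_finite\<close>), since $p > sp \ge n \ge 1$: the shell where
  $\ln R$ is about $k$ contributes about $k^{-p}$. The logarithm is what makes the
  borderline case $sp = n$ work.
\<close>

section \<open>Integrals of powers of the distance\<close>

text \<open>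
  All integrals of powers and logarithms below are estimated by cutting the domain into shells and
  bounding the integrand by a constant on each. The constants \<open>c k\<close> need to bound \<open>f\<close> only at those
  points of \<open>A k\<close> that are assigned to the \<open>k\<close>-th piece, so \<open>A k\<close> may be a whole ball around a
  shell, whose volume is at hand.
\<close>

lemma nn_integral_le_suminf_cover:
  fixes f :: "'a \<Rightarrow> ennreal"
  assumes meas: "\<And>k::nat. A k \<in> sets M"
    and cover: "\<And>y. f y \<noteq> 0 \<Longrightarrow> \<exists>k. y \<in> A k \<and> f y \<le> c k"
  shows "(\<integral>\<^sup>+y. f y \<partial>M) \<le> (\<Sum>k. c k * emeasure M (A k))"
proof -
  have "f y \<le> (\<Sum>k. c k * indicator (A k) y)" for y
  proof (cases "f y = 0")
    case False
    then obtain k where k: "y \<in> A k" "f y \<le> c k" using cover by blast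
    then have "f y \<le> (\<Sum>j\<in>{k}. c j * indicator (A j) y)" by simp
    also have "\<dots> \<le> (\<Sum>j. c j * indicator (A j) y)"
      by (rule sum_le_suminf) auto
    finally show ?thesis .
  qed simp
  then have "(\<integral>\<^sup>+y. f y \<partial>M) \<le> (\<integral>\<^sup>+y. (\<Sum>k. c k * indicator (A k) y) \<partial>M)"
    by (intro nn_integral_mono) auto
  also have "\<dots> = (\<Sum>k. \<integral>\<^sup>+y. c k * indicator (A k) y \<partial>M)"
    using meas by (intro nn_integral_suminf) auto
  also have "\<dots> = (\<Sum>k. c k * emeasure M (A k))"
    using meas by (simp add: nn_integral_cmult_indicator)
  finally show ?thesis .
qed

lemma powr_le_of_comparable:
  fixes t r a :: real
  assumes "0 < r" "r / 2 \<le> t" "t \<le> 2 * r"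
  shows "t powr (-a) \<le> 2 powr \<bar>a\<bar> * r powr (-a)"
proof -
  have t: "0 < t" using assms by linarith
  have "t powr (-a) = (t / r) powr (-a) * r powr (-a)"
    using t assms by (simp add: powr_divide)
  also have "(t / r) powr (-a) \<le> 2 powr \<bar>a\<bar>"
  proof -
    have "\<bar>ln (t / r)\<bar> \<le> ln 2"
    proof -
      have "ln (t/r) \<le> ln 2" using t assms by (simp add: field_simps)
      moreover have "ln (1/2) \<le> ln (t/r)" using t assms by (subst ln_le_cancel_iff) (auto simp: field_simps)
      ultimately show ?thesis by (simp add: ln_div)
    qed
    then have "\<bar>a\<bar> * \<bar>ln (t/r)\<bar> \<le> \<bar>a\<bar> * ln 2" by (intro mult_left_mono) auto
    moreover have "-a * ln (t/r) \<le> \<bar>a\<bar> * \<bar>ln (t/r)\<bar>"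
      by (metis abs_ge_self abs_minus_cancel abs_mult)
    ultimately show ?thesis using t assms by (simp add: powr_def)
  qed
  finally show ?thesis by (simp add: mult_right_mono)
qed

text \<open>
  On the shell of radius about $r l^k$ the integrand is about $(r l^k)^{-a}$ and the volume is at
  most a multiple of $(r l^k)^n$, so the integral is dominated by $r^{n - a}$ times a geometric
  series of ratio $l^{n - a}$. The ratio $l = 1/2$ serves balls and $l = 2$ serves complements of
  balls. The constant depends neither on the centre nor on the radius nor on the set.
\<close>

lemma nn_integral_powr_geometric_shells:
  fixes a l :: real
  assumes l: "0 < l" and conv: "l powr (real DIM('a::euclidean_space) - a) < 1"
  obtains C where "0 \<le> C" and
    "\<And>(c::'a) r S. 0 < r \<Longrightarrow>
       (\<And>y. y \<in> S \<Longrightarrow> \<exists>k::nat. r * l ^ k / 2 \<le> norm (y - c) \<and> norm (y - c) \<le> 2 * (r * l ^ k)) \<Longrightarrow>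
       (\<integral>\<^sup>+y. ennreal (norm (y - c) powr (-a)) * indicator S y \<partial>lborel)
         \<le> ennreal (C * r powr (real DIM('a) - a))"
proof
  define n where "n = real DIM('a)"
  define V where "V = unit_ball_vol n"
  have V: "0 \<le> V" by (simp add: V_def n_def)
  define g where "g = l powr (n - a)"
  have g: "0 < g" "g < 1" using l conv by (auto simp: g_def n_def)
  define C where "C = 2 powr \<bar>a\<bar> * V * 2 powr n * (1 / (1 - g))"
  show "0 \<le> C" using V g by (simp add: C_def)
  fix c :: 'a and r :: real and S
  assume r: "0 < r"
    and S: "\<And>y. y \<in> S \<Longrightarrow> \<exists>k::nat. r * l ^ k / 2 \<le> norm (y - c) \<and> norm (y - c) \<le> 2 * (r * l ^ k)"
  let ?A = "\<lambda>k::nat. cball c (2 * (r * l ^ k))"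
  let ?d = "\<lambda>k::nat. ennreal (2 powr \<bar>a\<bar> * (r * l ^ k) powr (-a))"
  have "(\<integral>\<^sup>+y. ennreal (norm (y - c) powr (-a)) * indicator S y \<partial>lborel)
      \<le> (\<Sum>k. ?d k * emeasure lborel (?A k))"
  proof (rule nn_integral_le_suminf_cover)
    fix y assume "ennreal (norm (y - c) powr (-a)) * indicator S y \<noteq> 0"
    then have yS: "y \<in> S" by (auto simp: indicator_def split: if_splits)
    then obtain k where k: "r * l ^ k / 2 \<le> norm (y - c)" "norm (y - c) \<le> 2 * (r * l ^ k)"
      using S by blast
    have "norm (y - c) powr (-a) \<le> 2 powr \<bar>a\<bar> * (r * l ^ k) powr (-a)"
      using k r l by (intro powr_le_of_comparable) auto
    moreover have "y \<in> ?A k" using k by (simp add: dist_norm norm_minus_commute)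
    ultimately show "\<exists>k. y \<in> ?A k \<and>
        ennreal (norm (y - c) powr (-a)) * indicator S y \<le> ?d k"
      using yS by (intro exI[of _ k]) (auto intro: ennreal_leI)
  qed simp
  also have "\<dots> = (\<Sum>k. ennreal (2 powr \<bar>a\<bar> * V * 2 powr n * r powr (n - a) * g ^ k))"
  proof (rule suminf_cong)
    fix k :: nat
    have pos: "0 < r * l ^ k" using r l by simp
    have lk: "(l ^ k) powr (n - a) = g ^ k"
      using l by (simp add: g_def powr_realpow[symmetric] powr_powr mult.commute)
    have "?d k * emeasure lborel (?A k)
        = ennreal (2 powr \<bar>a\<bar> * (r * l ^ k) powr (-a) * (V * (2 * (r * l ^ k)) powr n))"
      using pos V by (simp add: emeasure_cball V_def n_def powr_realpow ennreal_mult'' del: power_mult_distrib)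
    also have "2 powr \<bar>a\<bar> * (r * l ^ k) powr (-a) * (V * (2 * (r * l ^ k)) powr n)
        = 2 powr \<bar>a\<bar> * V * 2 powr n * ((r * l ^ k) powr (-a) * (r * l ^ k) powr n)"
      using pos powr_mult[of 2 "r * l ^ k" n] by simp
    also have "(r * l ^ k) powr (-a) * (r * l ^ k) powr n = (r * l ^ k) powr (n - a)"
      by (simp add: powr_add[symmetric])
    also have "(r * l ^ k) powr (n - a) = r powr (n - a) * g ^ k"
      using r l powr_mult[of r "l ^ k" "n - a"] by (simp add: lk)
    finally show "?d k * emeasure lborel (?A k)
        = ennreal (2 powr \<bar>a\<bar> * V * 2 powr n * r powr (n - a) * g ^ k)" by (simp add: mult_ac)
  qed
  also have "\<dots> = ennreal (\<Sum>k. 2 powr \<bar>a\<bar> * V * 2 powr n * r powr (n - a) * g ^ k)"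
    using g V by (intro suminf_ennreal2) (auto intro!: summable_mult summable_geometric)
  also have "(\<Sum>k. 2 powr \<bar>a\<bar> * V * 2 powr n * r powr (n - a) * g ^ k) = C * r powr (n - a)"
    using g by (subst suminf_mult) (auto simp: suminf_geometric C_def summable_geometric)
  finally show "(\<integral>\<^sup>+y. ennreal (norm (y - c) powr (-a)) * indicator S y \<partial>lborel)
         \<le> ennreal (C * r powr (real DIM('a) - a))" by (simp add: n_def)
qed

lemma ex_power2_bracket:
  fixes t :: real
  assumes "1 \<le> t"
  obtains k where "2 ^ k \<le> t" "t < 2 ^ (k + 1)"
proof -
  obtain k where k: "2 ^ k \<le> nat \<lfloor>t\<rfloor>" "nat \<lfloor>t\<rfloor> < 2 ^ (k + 1)"
    using ex_power_ivl1[of 2 "nat \<lfloor>t\<rfloor>"] assms by (auto simp: le_nat_iff)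
  have "real (2 ^ k) \<le> t" "t < real (2 ^ (k + 1))"
    using k assms by linarith+
  then show ?thesis using that[of k] by simp
qed

lemma nn_integral_powr_inside_ball:
  fixes a :: real
  assumes "a < real DIM('a::euclidean_space)"
  obtains C where "0 \<le> C" and
    "\<And>(c::'a) r. 0 < r \<Longrightarrow>
       (\<integral>\<^sup>+y. ennreal (norm (y - c) powr (-a)) * indicator {y. norm (y - c) \<le> r} y \<partial>lborel)
         \<le> ennreal (C * r powr (real DIM('a) - a))"
proof -
  have "(1/2::real) powr (real DIM('a) - a) < 1"
    using assms powr_less_mono'[of "1/2" 0 "real DIM('a) - a"] by simp
  then obtain C where C: "0 \<le> C" and
    *: "\<And>(c::'a) r S. 0 < r \<Longrightarrow>
       (\<And>y. y \<in> S \<Longrightarrow> \<exists>k::nat. r * (1/2) ^ k / 2 \<le> norm (y - c) \<and> norm (y - c) \<le> 2 * (r * (1/2) ^ k)) \<Longrightarrow>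
       (\<integral>\<^sup>+y. ennreal (norm (y - c) powr (-a)) * indicator S y \<partial>lborel)
         \<le> ennreal (C * r powr (real DIM('a) - a))"
    by (rule nn_integral_powr_geometric_shells[rotated]) auto
  have "(\<integral>\<^sup>+y. ennreal (norm (y - c) powr (-a)) * indicator {y. norm (y - c) \<le> r} y \<partial>lborel)
         \<le> ennreal (C * r powr (real DIM('a) - a))" if r: "0 < r" for c :: 'a and r
  proof -
    \<comment> \<open>The centre lies in no shell, but there the integrand is 0 powr (-a) = 0.\<close>
    have "(\<integral>\<^sup>+y. ennreal (norm (y - c) powr (-a)) * indicator {y. norm (y - c) \<le> r} y \<partial>lborel)
        = (\<integral>\<^sup>+y. ennreal (norm (y - c) powr (-a)) * indicator {y. 0 < norm (y - c) \<and> norm (y - c) \<le> r} y \<partial>lborel)"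
      by (intro nn_integral_cong) (auto simp: indicator_def)
    also have "\<dots> \<le> ennreal (C * r powr (real DIM('a) - a))"
    proof (rule *[OF r])
      fix y assume "y \<in> {y. 0 < norm (y - c) \<and> norm (y - c) \<le> r}"
      then have y: "0 < norm (y - c)" "norm (y - c) \<le> r" by auto
      let ?t = "r / norm (y - c)"
      have t: "1 \<le> ?t" using y by simp
      obtain k where k: "2 ^ k \<le> ?t" "?t < 2 ^ (k + 1)"
        using ex_power2_bracket[OF t] by blast
      show "\<exists>k::nat. r * (1/2) ^ k / 2 \<le> norm (y - c) \<and> norm (y - c) \<le> 2 * (r * (1/2) ^ k)"
        using k y r by (intro exI[of _ k]) (auto simp: field_simps power_one_over)
    qed
    finally show ?thesis .
  qed
  with C show ?thesis by (rule that)
qed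

lemma nn_integral_powr_outside_ball:
  fixes a :: real
  assumes "real DIM('a::euclidean_space) < a"
  obtains C where "0 \<le> C" and
    "\<And>(c::'a) r. 0 < r \<Longrightarrow>
       (\<integral>\<^sup>+y. ennreal (norm (y - c) powr (-a)) * indicator {y. r / 2 \<le> norm (y - c)} y \<partial>lborel)
         \<le> ennreal (C * r powr (real DIM('a) - a))"
proof -
  have "(2::real) powr (real DIM('a) - a) < 1"
    using assms powr_less_mono[of "real DIM('a) - a" 0 2] by simp
  then obtain C where C: "0 \<le> C" and
    *: "\<And>(c::'a) r S. 0 < r \<Longrightarrow>
       (\<And>y. y \<in> S \<Longrightarrow> \<exists>k::nat. r * 2 ^ k / 2 \<le> norm (y - c) \<and> norm (y - c) \<le> 2 * (r * 2 ^ k)) \<Longrightarrow>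
       (\<integral>\<^sup>+y. ennreal (norm (y - c) powr (-a)) * indicator S y \<partial>lborel)
         \<le> ennreal (C * r powr (real DIM('a) - a))"
    by (rule nn_integral_powr_geometric_shells[rotated]) auto
  have "(\<integral>\<^sup>+y. ennreal (norm (y - c) powr (-a)) * indicator {y. r / 2 \<le> norm (y - c)} y \<partial>lborel)
         \<le> ennreal (C * r powr (real DIM('a) - a))" if r: "0 < r" for c :: 'a and r
  proof (rule *[OF r])
    fix y assume "y \<in> {y. r / 2 \<le> norm (y - c)}"
    then have t: "1 \<le> 2 * norm (y - c) / r" using r by (simp add: field_simps)
    obtain k where k: "2 ^ k \<le> 2 * norm (y - c) / r" "2 * norm (y - c) / r < 2 ^ (k + 1)"
      using ex_power2_bracket[OF t] by blast
    show "\<exists>k::nat. r * 2 ^ k / 2 \<le> norm (y - c) \<and> norm (y - c) \<le> 2 * (r * 2 ^ k)"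
      using k r by (intro exI[of _ k]) (auto simp: field_simps)
  qed
  with C show ?thesis by (rule that)
qed

section \<open>Oscillation of the iterated logarithm\<close>

lemma abs_ln_diff_le:
  fixes a b :: real
  assumes "0 < m" "m \<le> a" "m \<le> b"
  shows "\<bar>ln a - ln b\<bar> \<le> \<bar>a - b\<bar> / m"
proof -
  have *: "ln x - ln y \<le> \<bar>x - y\<bar> / m" if "m \<le> x" "m \<le> y" for x y
  proof -
    have "ln x - ln y \<le> (x - y) / y" using ln_diff_le[of x y] that assms by linarith
    also have "\<dots> \<le> \<bar>x - y\<bar> / m" using that assms by (intro frac_le) auto
    finally show ?thesis .
  qed
  show ?thesis using *[of a b] *[of b a] assms by (simp add: abs_le_iff abs_minus_commute)
qed

text \<open>
  The mean value theorem gives $|a - b| / \min(a, b)$. To have $a$ itself in the denominator when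
  $b < a$, a factor $a / b = 1 + (a - b) / b \le 1 + (a - b)$ is spent, which accounts for the
  quadratic term. For $a = \ln R(x)$ this produces the gain $1 / \ln R(x)$ uniformly in $y$, also
  for $y$ near the origin, where the function is far from its value at $x$.
\<close>

lemma abs_ln_diff_le_of_ge_1:
  fixes a b :: real
  assumes "1 \<le> a" "1 \<le> b"
  shows "\<bar>ln a - ln b\<bar> \<le> (\<bar>a - b\<bar> + \<bar>a - b\<bar>\<^sup>2) / a"
proof (cases "a \<le> b")
  case True
  then have "\<bar>ln a - ln b\<bar> \<le> \<bar>a - b\<bar> / a" using assms by (intro abs_ln_diff_le) auto
  also have "\<dots> \<le> (\<bar>a - b\<bar> + \<bar>a - b\<bar>\<^sup>2) / a" using assms by (intro divide_right_mono) auto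
  finally show ?thesis .
next
  case False
  define d where "d = a - b"
  have d: "0 < d" "a = b + d" using False by (auto simp: d_def)
  have "\<bar>ln a - ln b\<bar> \<le> \<bar>a - b\<bar> / b" using False assms by (intro abs_ln_diff_le) auto
  also have "\<bar>a - b\<bar> = d" using d by simp
  also have "d / b \<le> (d + d\<^sup>2) / a"
  proof -
    have "d * d \<le> b * (d * d)" using assms by (simp add: mult_le_cancel_right1)
    then show ?thesis using assms d by (simp add: field_simps power2_eq_square)
  qed
  finally show ?thesis using d by simp
qed

text \<open>
  With $d$ the modulus of the logarithm of a ratio, the right-hand side is a multiple of an
  arbitrarily small power of that ratio or of its inverse; this is how logarithmic growth is absorbed into powers.
\<close>

lemma add_square_le_exp:
  fixes d e :: real
  assumes "0 \<le> d" "0 < e"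
  shows "d + d\<^sup>2 \<le> (1 / e + 2 / e\<^sup>2) * exp (e * d)"
proof -
  have E: "1 + e * d + (e * d)\<^sup>2 / 2 \<le> exp (e * d)"
    using assms by (intro exp_lower_Taylor_quadratic) auto
  moreover have "0 \<le> e * d" "0 \<le> (e * d)\<^sup>2" using assms by auto
  ultimately have "e * d \<le> exp (e * d)" "(e * d)\<^sup>2 \<le> 2 * exp (e * d)" by linarith+
  then have "d \<le> 1 / e * exp (e * d)" "d\<^sup>2 \<le> 2 / e\<^sup>2 * exp (e * d)"
    using assms by (simp_all add: field_simps power_mult_distrib)
  then show ?thesis by (simp add: distrib_right)
qed

text \<open>
  The shift by $e$ makes $\ln R \ge 1$, so that the iterated logarithm is defined and nonnegative
  everywhere, and Lipschitz as a function of $\ln R$.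
\<close>

definition shifted_norm :: "'a::real_normed_vector \<Rightarrow> real" where
  "shifted_norm x = exp 1 + norm x"

definition slow_wave :: "'a::real_normed_vector \<Rightarrow> real" where
  "slow_wave x = sin (ln (ln (shifted_norm x)))"

lemma shifted_norm_ge: "exp 1 \<le> shifted_norm x" "1 \<le> shifted_norm x" "0 < shifted_norm x"
    "norm x \<le> shifted_norm x"
  using one_le_exp_iff[of 1] exp_ge_add_one_self[of "1::real"] norm_ge_zero[of x] unfolding shifted_norm_def by (linarith+)

lemma ln_shifted_norm_ge_1: "1 \<le> ln (shifted_norm x)"
  using shifted_norm_ge[of x] by (simp add: ln_ge_iff)

lemma abs_shifted_norm_diff_le: "\<bar>shifted_norm x - shifted_norm y\<bar> \<le> norm (x - y)"
  by (simp add: shifted_norm_def norm_triangle_ineq3)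

lemma abs_sin_diff_le: "\<bar>sin a - sin b\<bar> \<le> \<bar>a - b\<bar>" for a b :: real
proof -
  have "\<bar>sin a - sin b\<bar> = 2 * (\<bar>sin ((a - b) / 2)\<bar> * \<bar>cos ((a + b) / 2)\<bar>)"
    by (simp add: sin_diff_sin abs_mult)
  also have "\<bar>sin ((a - b) / 2)\<bar> * \<bar>cos ((a + b) / 2)\<bar> \<le> \<bar>(a - b) / 2\<bar> * 1"
    by (intro mult_mono abs_sin_x_le_abs_x) auto
  finally show ?thesis by simp
qed

lemma slow_wave_diff_le:
  defines "d \<equiv> \<lambda>x y. \<bar>ln (shifted_norm x) - ln (shifted_norm y)\<bar>"
  shows "\<bar>slow_wave x - slow_wave y\<bar> \<le> (d x y + (d x y)\<^sup>2) / ln (shifted_norm x)"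
  unfolding slow_wave_def d_def
  by (rule order_trans[OF abs_sin_diff_le abs_ln_diff_le_of_ge_1[OF ln_shifted_norm_ge_1 ln_shifted_norm_ge_1]])

lemma continuous_on_slow_wave: "continuous_on A slow_wave"
proof -
  have ne: "shifted_norm x \<noteq> 0" "ln (shifted_norm x) \<noteq> 0" for x :: 'a
    using shifted_norm_ge(3)[of x] ln_shifted_norm_ge_1[of x] by linarith+
  have "continuous_on A (\<lambda>x::'a. shifted_norm x)"
    unfolding shifted_norm_def by (intro continuous_intros)
  then show ?thesis
    unfolding slow_wave_def using ne by (intro continuous_intros) auto
qed

text \<open>
  The curve meets every sphere of large radius after any given time, and the radii with
  $\ln (\ln R) = a + 2 \pi k$ are unbounded. So $\sin a$ is a value at arbitrarily late times
  for every $a$, and a limit would have to equal all of these.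
\<close>

lemma slow_wave_no_limit_along_curve:
  fixes \<gamma> :: "real \<Rightarrow> 'a::real_normed_vector"
  assumes cont: "continuous_on {0..} \<gamma>" and lim: "filterlim \<gamma> at_infinity at_top"
  shows "\<not> ((\<lambda>t. slow_wave (\<gamma> t)) \<longlongrightarrow> l) at_top"
proof
  assume L: "((\<lambda>t. slow_wave (\<gamma> t)) \<longlongrightarrow> l) at_top"
  have norm_lim: "filterlim (\<lambda>t. norm (\<gamma> t)) at_top at_top"
    using lim by (rule filterlim_at_infinity_imp_norm_at_top)
  have hit: "\<exists>t\<ge>T. slow_wave (\<gamma> t) = sin a" for T a
  proof -
    \<comment> \<open>The curve is continuous only for nonnegative times.\<close>
    define T' where "T' = max T 0"
    define r0 where "r0 = norm (\<gamma> T')"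
    obtain k :: nat where k: "ln (ln (exp 1 + r0)) \<le> a + 2 * pi * real k"
    proof -
      obtain k :: nat where "(ln (ln (exp 1 + r0)) - a) / (2 * pi) \<le> real k"
        using real_arch_simple by blast
      then show ?thesis by (intro that[of k]) (simp add: field_simps)
    qed
    define b where "b = a + 2 * pi * real k"
    define r where "r = exp (exp b) - exp 1"
    have "1 \<le> ln (exp 1 + r0)" using ln_shifted_norm_ge_1[of "\<gamma> T'"] by (simp add: shifted_norm_def r0_def)
    then have "ln (exp 1 + r0) \<le> exp b"
      using k by (subst ln_le_cancel_iff[symmetric]) (auto simp: b_def)
    moreover have "0 < exp 1 + r0" by (simp add: r0_def add_pos_nonneg)
    ultimately have r: "r0 \<le> r"
      unfolding r_def using exp_le_cancel_iff[of "ln (exp 1 + r0)" "exp b"] by simp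
    obtain T2 where T2: "T' \<le> T2" "r \<le> norm (\<gamma> T2)"
    proof -
      have "eventually (\<lambda>t. r \<le> norm (\<gamma> t) \<and> T' \<le> t) at_top"
        using norm_lim by (intro eventually_conj) (auto simp: filterlim_at_top eventually_ge_at_top)
      then show ?thesis using that by (auto simp: eventually_at_top_linorder)
    qed
    have "continuous_on {T'..T2} (\<lambda>t. norm (\<gamma> t))"
      by (intro continuous_on_norm continuous_on_subset[OF cont]) (auto simp: T'_def)
    then obtain t where t: "T' \<le> t" "norm (\<gamma> t) = r"
      using IVT'[of "\<lambda>t. norm (\<gamma> t)" T' r T2] r T2 by (auto simp: r0_def)
    have "slow_wave (\<gamma> t) = sin (a + 2 * pi * real k)"
      using t by (simp add: slow_wave_def shifted_norm_def r_def b_def)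
    also have "\<dots> = sin a"
    proof -
      have "sin (2 * pi * real k) = 0" "cos (2 * pi * real k) = 1"
        using sin_2npi[of k] cos_2npi[of k] by (simp_all only: mult.commute mult.left_commute)
      then show ?thesis by (simp only: sin_add)
    qed
    finally show ?thesis using t by (intro exI[of _ t]) (auto simp: T'_def)
  qed
  have "l = sin a" for a
  proof (rule ccontr)
    assume "l \<noteq> sin a"
    then have "eventually (\<lambda>t. slow_wave (\<gamma> t) \<noteq> sin a) at_top"
      using L by (metis tendsto_imp_eventually_ne)
    then show False using hit[of _ a] by (auto simp: eventually_at_top_linorder)
  qed
  from this[of 0] this[of "pi/2"] show False by simp
qed

section \<open>The seminorm of the slow wave\<close>

text \<open>
  The three alternatives are the regions in which different effects dominate. If $y$ is much closer
  to $x$ than $R$, then $d$ is at most a multiple of $h / R$, so the gain is the factor $(h / R)^q$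
  of a Lipschitz function. If $y$ is far from $x$ and $R(y) > R(x)$, then $d$ is the logarithm of
  $R(y) / R(x) \le 3 h / R$, which costs a factor $(h / R)^e$. If $y$ is far from $x$ and
  $R(y) \le R(x)$, the distance $h$ is bounded below by $R / 2$, but $R(y)$ may be much smaller than
  $R(x)$, which costs a factor $(R / |y|)^e$. The quotient is used with $m = n + sq$.
  For small $e$ each right-hand side has a finite integral in $y$ over its region.
\<close>

lemma slow_wave_quotient_le:
  fixes q m e :: real
  assumes q: "0 < q" and m: "0 < m" and e: "0 < e"
  obtains C where "0 \<le> C" and
    "\<And>x y :: 'a::real_normed_vector.
       let R = shifted_norm x; L = ln R; h = norm (y - x);
           Q = \<bar>slow_wave x - slow_wave y\<bar> powr q / h powr m
       in y \<noteq> 0 \<longrightarrow>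
          h \<le> R \<and> Q \<le> C * L powr (-q) * R powr (-q) * h powr (-(m - q)) \<or>
          R / 2 \<le> h \<and> Q \<le> C * L powr (-q) * R powr (-e) * h powr (-(m - e)) \<or>
          norm y \<le> R \<and> Q \<le> C * L powr (-q) * R powr (e - m) * norm y powr (-e)"
proof
  \<comment> \<open>The exponent is divided by q because the bound on d + d^2 is raised to the power q.\<close>
  define K where "K = 1 / (e / q) + 2 / (e / q)\<^sup>2"
  have K: "0 \<le> K" using q e by (simp add: K_def)
  define C where "C = 4 powr q + K powr q * 3 powr e + K powr q * 2 powr m"
  have C: "4 powr q \<le> C" "K powr q * 3 powr e \<le> C" "K powr q * 2 powr m \<le> C"
    by (simp_all add: C_def)
  then show "0 \<le> C" by (meson order_trans powr_ge_zero)
  fix x y :: 'a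
  define R where "R = shifted_norm x"
  define S where "S = shifted_norm y"
  define L where "L = ln R"
  define h where "h = norm (y - x)"
  define d where "d = \<bar>ln R - ln S\<bar>"
  define Q where "Q = \<bar>slow_wave x - slow_wave y\<bar> powr q / h powr m"
  have R: "0 < R" and S: "0 < S" "norm y \<le> S" and L: "1 \<le> L"
    using shifted_norm_ge ln_shifted_norm_ge_1 by (auto simp: R_def S_def L_def)
  have d: "0 \<le> d" by (simp add: d_def)
  have h: "0 \<le> h" by (simp add: h_def)
  have RS: "\<bar>R - S\<bar> \<le> h"
    using abs_shifted_norm_diff_le[of x y] by (simp add: R_def S_def h_def norm_minus_commute)
  have Q: "Q \<le> L powr (-q) * (d + d\<^sup>2) powr q * h powr (-m)"
  proof -
    have "\<bar>slow_wave x - slow_wave y\<bar> \<le> (d + d\<^sup>2) / L"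
      using slow_wave_diff_le[of x y] by (simp add: d_def R_def S_def L_def)
    then have "\<bar>slow_wave x - slow_wave y\<bar> powr q \<le> ((d + d\<^sup>2) / L) powr q"
      using q by (intro powr_mono2) auto
    also have "\<dots> = L powr (-q) * (d + d\<^sup>2) powr q"
      using L d by (simp add: powr_divide powr_minus_divide)
    finally have "\<bar>slow_wave x - slow_wave y\<bar> powr q * h powr (-m)
        \<le> L powr (-q) * (d + d\<^sup>2) powr q * h powr (-m)"
      by (rule mult_right_mono) simp
    moreover have "Q = \<bar>slow_wave x - slow_wave y\<bar> powr q * h powr (-m)"
      by (simp add: Q_def powr_minus_divide)
    ultimately show ?thesis by simp
  qed
  have Q_le: "Q \<le> C * L powr (-q) * T"
    if "(d + d\<^sup>2) powr q * h powr (-m) \<le> c * T" "c \<le> C" "0 \<le> T" for c T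
  proof -
    have "(d + d\<^sup>2) powr q * h powr (-m) \<le> C * T"
      using that by (meson mult_right_mono order_trans)
    then have "L powr (-q) * ((d + d\<^sup>2) powr q * h powr (-m)) \<le> L powr (-q) * (C * T)"
      by (intro mult_left_mono) auto
    then show ?thesis using Q by (simp add: mult_ac)
  qed
  have "h \<le> R \<and> Q \<le> C * L powr (-q) * R powr (-q) * h powr (-(m - q)) \<or>
        R / 2 \<le> h \<and> Q \<le> C * L powr (-q) * R powr (-e) * h powr (-(m - e)) \<or>
        norm y \<le> R \<and> Q \<le> C * L powr (-q) * R powr (e - m) * norm y powr (-e)"
    if y: "y \<noteq> 0"
  proof (cases "h < R / 2")
    case True
    have "d \<le> \<bar>R - S\<bar> / (R / 2)"
      unfolding d_def using True RS R by (intro abs_ln_diff_le) linarith+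
    also have "\<dots> \<le> h / (R / 2)" using RS R by (intro divide_right_mono) auto
    finally have d_le: "d \<le> 2 * h / R" by (simp add: mult.commute)
    moreover have "2 * h / R \<le> 1" using True R by (simp add: field_simps)
    ultimately have "d\<^sup>2 \<le> d" using d by (simp add: power2_eq_square mult_left_le)
    with d_le have "d + d\<^sup>2 \<le> 4 * h / R" by simp
    then have "(d + d\<^sup>2) powr q \<le> (4 * h / R) powr q"
      using q d by (intro powr_mono2) auto
    also have "\<dots> = 4 powr q * (R powr (-q) * h powr q)"
      using R h by (simp add: powr_divide powr_mult powr_minus_divide)
    finally have "(d + d\<^sup>2) powr q * h powr (-m) \<le> 4 powr q * (R powr (-q) * h powr q) * h powr (-m)"
      by (rule mult_right_mono) simp
    also have "\<dots> = 4 powr q * (R powr (-q) * h powr (-(m - q)))"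
      using powr_add[of h q "-m"] by simp
    finally have "Q \<le> C * L powr (-q) * (R powr (-q) * h powr (-(m - q)))"
      by (rule Q_le) (use C in auto)
    then show ?thesis using True R by (auto simp: mult.assoc)
  next
    case False
    have "(d + d\<^sup>2) powr q \<le> (K * exp (e / q * d)) powr q"
      unfolding K_def using q d e by (intro powr_mono2 add_square_le_exp) auto
    also have "\<dots> = K powr q * exp (e * d)"
      using q K by (simp add: powr_mult powr_def[of "exp _"])
    finally have dq: "(d + d\<^sup>2) powr q \<le> K powr q * exp (e * d)" .
    show ?thesis
    proof (cases "S \<le> R")
      case True
      have "exp (e * d) = R powr e * S powr (-e)"
        using True R S by (simp add: d_def powr_def exp_add[symmetric] algebra_simps)
      also have "\<dots> \<le> R powr e * norm y powr (-e)"
        using S y e by (intro mult_left_mono powr_mono2') auto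
      finally have 1: "exp (e * d) \<le> R powr e * norm y powr (-e)" .
      have "h powr (-m) \<le> (R / 2) powr (-m)"
        using False R m by (intro powr_mono2') auto
      also have "\<dots> = 2 powr m * R powr (-m)"
        using R by (simp add: powr_divide powr_minus_divide)
      finally have 2: "h powr (-m) \<le> 2 powr m * R powr (-m)" .
      have "(d + d\<^sup>2) powr q * h powr (-m)
          \<le> (K powr q * (R powr e * norm y powr (-e))) * (2 powr m * R powr (-m))"
        by (intro mult_mono 2 order_trans[OF dq mult_left_mono[OF 1]]) auto
      also have "\<dots> = K powr q * 2 powr m * (R powr (e - m) * norm y powr (-e))"
        using powr_add[of R e "-m"] by (simp add: mult_ac)
      finally have "Q \<le> C * L powr (-q) * (R powr (e - m) * norm y powr (-e))"
        by (rule Q_le) (use C in auto)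
      then show ?thesis using True S by (auto simp: mult.assoc)
    next
      case S_gt: False
      have "exp (e * d) = S powr e * R powr (-e)"
        using S_gt R S by (simp add: d_def powr_def exp_add[symmetric] algebra_simps)
      also have "\<dots> \<le> (3 * h) powr e * R powr (-e)"
        using S e RS False by (intro mult_right_mono powr_mono2) auto
      also have "\<dots> = 3 powr e * (R powr (-e) * h powr e)" using h by (simp add: powr_mult)
      finally have 3: "exp (e * d) \<le> 3 powr e * (R powr (-e) * h powr e)" .
      have "(d + d\<^sup>2) powr q \<le> K powr q * (3 powr e * (R powr (-e) * h powr e))"
        by (rule order_trans[OF dq mult_left_mono[OF 3]]) simp
      then have "(d + d\<^sup>2) powr q * h powr (-m)
          \<le> K powr q * (3 powr e * (R powr (-e) * h powr e)) * h powr (-m)"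
        by (rule mult_right_mono) simp
      also have "\<dots> = K powr q * 3 powr e * (R powr (-e) * h powr (-(m - e)))"
        using powr_add[of h e "-m"] by simp
      finally have "Q \<le> C * L powr (-q) * (R powr (-e) * h powr (-(m - e)))"
        by (rule Q_le) (use C in auto)
      then show ?thesis using False by (auto simp: mult.assoc)
    qed
  qed
  then show "let R = shifted_norm x; L = ln R; h = norm (y - x);
           Q = \<bar>slow_wave x - slow_wave y\<bar> powr q / h powr m
       in y \<noteq> 0 \<longrightarrow>
          h \<le> R \<and> Q \<le> C * L powr (-q) * R powr (-q) * h powr (-(m - q)) \<or>
          R / 2 \<le> h \<and> Q \<le> C * L powr (-q) * R powr (-e) * h powr (-(m - e)) \<or>
          norm y \<le> R \<and> Q \<le> C * L powr (-q) * R powr (e - m) * norm y powr (-e)"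
    unfolding Let_def R_def L_def h_def Q_def by blast
qed

text \<open>
  Each of the three terms bounding the quotient is a power of a distance, and its exponent is on the
  side of $n$ that makes the integral converge over its region: $s < 1$ gives $n + sq - q < n$ near
  $x$, and $0 < e < \min(sq, n)$ gives $n + sq - e > n$ far from $x$ and $e < n$ around the origin.
  All three have the same homogeneity, hence the same power $R^{-sq}$.
\<close>

lemma slow_wave_inner_integral_le:
  fixes q s :: real
  assumes q: "0 < q" and s: "0 < s" "s < 1"
  obtains C where "0 \<le> C" and
    "\<And>x :: 'a::euclidean_space.
      (\<integral>\<^sup>+ y. ennreal (\<bar>slow_wave x - slow_wave y\<bar> powr q / norm (x - y) powr (real DIM('a) + s * q)) \<partial>lborel)
        \<le> ennreal (C * (shifted_norm x powr (-s * q) * ln (shifted_norm x) powr (-q)))"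
proof -
  define n where "n = real DIM('a)"
  define m where "m = n + s * q"
  define e where "e = min (s * q) n / 2"
  have n: "0 < n" by (simp add: n_def)
  have sq: "0 < s * q" "s * q < q" using q s by auto
  have e: "0 < e" "e < n" "e < s * q" using n sq by (auto simp: e_def)
  have m: "0 < m" "m - q < n" "n < m - e" using n sq e by (auto simp: m_def)
  obtain C where C: "0 \<le> C" and
    bound: "\<And>x y :: 'a.
       let R = shifted_norm x; L = ln R; h = norm (y - x);
           Q = \<bar>slow_wave x - slow_wave y\<bar> powr q / h powr m
       in y \<noteq> 0 \<longrightarrow>
          h \<le> R \<and> Q \<le> C * L powr (-q) * R powr (-q) * h powr (-(m - q)) \<or>
          R / 2 \<le> h \<and> Q \<le> C * L powr (-q) * R powr (-e) * h powr (-(m - e)) \<or>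
          norm y \<le> R \<and> Q \<le> C * L powr (-q) * R powr (e - m) * norm y powr (-e)"
    by (fact slow_wave_quotient_le[OF q m(1) e(1)])
  obtain C1 where C1: "0 \<le> C1" "\<And>(c::'a) r. 0 < r \<Longrightarrow>
       (\<integral>\<^sup>+y. ennreal (norm (y - c) powr (-(m - q))) * indicator {y. norm (y - c) \<le> r} y \<partial>lborel)
         \<le> ennreal (C1 * r powr (n - (m - q)))"
    unfolding n_def by (fact nn_integral_powr_inside_ball[OF m(2)[unfolded n_def]])
  obtain C2 where C2: "0 \<le> C2" "\<And>(c::'a) r. 0 < r \<Longrightarrow>
       (\<integral>\<^sup>+y. ennreal (norm (y - c) powr (-(m - e))) * indicator {y. r / 2 \<le> norm (y - c)} y \<partial>lborel)
         \<le> ennreal (C2 * r powr (n - (m - e)))"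
    unfolding n_def by (fact nn_integral_powr_outside_ball[OF m(3)[unfolded n_def]])
  obtain C3 where C3: "0 \<le> C3" "\<And>(c::'a) r. 0 < r \<Longrightarrow>
       (\<integral>\<^sup>+y. ennreal (norm (y - c) powr (-e)) * indicator {y. norm (y - c) \<le> r} y \<partial>lborel)
         \<le> ennreal (C3 * r powr (n - e))"
    unfolding n_def by (fact nn_integral_powr_inside_ball[OF e(2)[unfolded n_def]])
  have "(\<integral>\<^sup>+ y. ennreal (\<bar>slow_wave x - slow_wave y\<bar> powr q / norm (x - y) powr (real DIM('a) + s * q)) \<partial>lborel)
        \<le> ennreal (C * (C1 + C2 + C3) * (shifted_norm x powr (-s * q) * ln (shifted_norm x) powr (-q)))"
    for x :: 'a
  proof -
    define R where "R = shifted_norm x"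
    define L where "L = ln R"
    have R: "0 < R" using shifted_norm_ge by (simp add: R_def)
    define Q where "Q y = \<bar>slow_wave x - slow_wave y\<bar> powr q / norm (y - x) powr m" for y
    define F1 where "F1 y = ennreal (norm (y - x) powr (-(m - q))) * indicator {y. norm (y - x) \<le> R} y" for y
    define F2 where "F2 y = ennreal (norm (y - x) powr (-(m - e))) * indicator {y. R / 2 \<le> norm (y - x)} y" for y
    define F3 where "F3 y = ennreal (norm (y - 0) powr (-e)) * indicator {y. norm (y - 0) \<le> R} y" for y :: 'a
    have [measurable]: "F1 \<in> borel_measurable borel" "F2 \<in> borel_measurable borel" "F3 \<in> borel_measurable borel"
      unfolding F1_def F2_def F3_def by measurable
    define c1 where "c1 = C * L powr (-q) * R powr (-q)"
    define c2 where "c2 = C * L powr (-q) * R powr (-e)"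
    define c3 where "c3 = C * L powr (-q) * R powr (e - m)"
    have c: "0 \<le> c1" "0 \<le> c2" "0 \<le> c3" using C by (auto simp: c1_def c2_def c3_def)
    have "ennreal (Q y) \<le> ennreal c1 * F1 y + ennreal c2 * F2 y + ennreal c3 * F3 y" if y: "y \<noteq> 0" for y
    proof -
      consider "norm (y - x) \<le> R" "Q y \<le> c1 * norm (y - x) powr (-(m - q))"
        | "R / 2 \<le> norm (y - x)" "Q y \<le> c2 * norm (y - x) powr (-(m - e))"
        | "norm y \<le> R" "Q y \<le> c3 * norm y powr (-e)"
        using bound[of x y] y unfolding Let_def R_def L_def Q_def c1_def c2_def c3_def by blast
      then show ?thesis
      proof cases
        case 1
        then have "ennreal (Q y) \<le> ennreal c1 * F1 y"
          using c by (simp add: F1_def ennreal_mult[symmetric] ennreal_leI)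
        then show ?thesis by (simp add: add_increasing2)
      next
        case 2
        then have "ennreal (Q y) \<le> ennreal c2 * F2 y"
          using c by (simp add: F2_def ennreal_mult[symmetric] ennreal_leI)
        then show ?thesis by (simp add: add_increasing add_increasing2)
      next
        case 3
        then have "ennreal (Q y) \<le> ennreal c3 * F3 y"
          using c by (simp add: F3_def ennreal_mult[symmetric] ennreal_leI)
        then show ?thesis by (simp add: add_increasing)
      qed
    qed
    then have "(\<integral>\<^sup>+ y. ennreal (Q y) \<partial>lborel)
        \<le> (\<integral>\<^sup>+ y. ennreal c1 * F1 y + ennreal c2 * F2 y + ennreal c3 * F3 y \<partial>lborel)"
      using AE_lborel_singleton[of "0::'a"] by (intro nn_integral_mono_AE) (auto elim: eventually_mono)
    also have "\<dots> = ennreal c1 * integral\<^sup>N lborel F1 + ennreal c2 * integral\<^sup>N lborel F2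
        + ennreal c3 * integral\<^sup>N lborel F3"
      by (simp add: nn_integral_add nn_integral_cmult)
    also have "\<dots> \<le> ennreal c1 * ennreal (C1 * R powr (n - (m - q)))
        + ennreal c2 * ennreal (C2 * R powr (n - (m - e))) + ennreal c3 * ennreal (C3 * R powr (n - e))"
      unfolding F1_def F2_def F3_def by (intro add_mono mult_left_mono C1 C2 C3 R) auto
    also have "\<dots> = ennreal (c1 * (C1 * R powr (n - (m - q))) + c2 * (C2 * R powr (n - (m - e)))
        + c3 * (C3 * R powr (n - e)))"
      using c C1(1) C2(1) C3(1) by (simp add: ennreal_mult)
    also have "c1 * (C1 * R powr (n - (m - q))) + c2 * (C2 * R powr (n - (m - e))) + c3 * (C3 * R powr (n - e))
        = C * (C1 + C2 + C3) * (R powr (-s * q) * L powr (-q))"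
    proof -
      have "R powr (-q) * R powr (n - (m - q)) = R powr (-s * q)"
        "R powr (-e) * R powr (n - (m - e)) = R powr (-s * q)"
        "R powr (e - m) * R powr (n - e) = R powr (-s * q)"
        by (simp_all add: powr_add[symmetric] m_def)
      then have "c1 * (C1 * R powr (n - (m - q))) = C * L powr (-q) * C1 * R powr (-s * q)"
        "c2 * (C2 * R powr (n - (m - e))) = C * L powr (-q) * C2 * R powr (-s * q)"
        "c3 * (C3 * R powr (n - e)) = C * L powr (-q) * C3 * R powr (-s * q)"
        unfolding c1_def c2_def c3_def by (simp_all only: mult_ac)
      then show ?thesis by (simp only: distrib_left distrib_right mult_ac)
    qed
    finally show ?thesis
      by (simp add: Q_def R_def L_def m_def n_def norm_minus_commute)
  qed
  then show ?thesis using C C1(1) C2(1) C3(1) by (intro that[of "C * (C1 + C2 + C3)"]) auto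
qed

text \<open>
  The power $R^{-n}$ alone just fails to be integrable: each of the shells $e^{k+1} \le R < e^{k+2}$
  contributes a bounded amount. The logarithm turns this contribution into a multiple of
  $(k + 1)^{-p}$.
\<close>

lemma nn_integral_log_critical_power_finite:
  fixes p :: real
  assumes p: "1 < p"
  shows "(\<integral>\<^sup>+ x. ennreal (shifted_norm x powr (- real DIM('a)) * ln (shifted_norm x) powr (-p))
           \<partial>(lborel :: 'a::euclidean_space measure)) < \<infinity>"
proof -
  define n where "n = real DIM('a)"
  define V where "V = unit_ball_vol n"
  have n: "0 < n" and V: "0 \<le> V" by (auto simp: V_def n_def)
  let ?A = "\<lambda>k::nat. cball (0::'a) (exp (real k + 2))"
  let ?c = "\<lambda>k::nat. ennreal (exp (real k + 1) powr (-n) * real (Suc k) powr (-p))"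
  have "(\<integral>\<^sup>+ x. ennreal (shifted_norm x powr (-n) * ln (shifted_norm x) powr (-p)) \<partial>(lborel :: 'a measure))
      \<le> (\<Sum>k. ?c k * emeasure lborel (?A k))"
  proof (rule nn_integral_le_suminf_cover)
    fix x :: 'a
    define R where "R = shifted_norm x"
    define k where "k = nat \<lfloor>ln R\<rfloor> - 1"
    have R: "0 < R" "norm x \<le> R" and L: "1 \<le> ln R"
      using shifted_norm_ge ln_shifted_norm_ge_1 by (auto simp: R_def)
    have k: "real k + 1 \<le> ln R" "ln R \<le> real k + 2"
      using L unfolding k_def by linarith+
    have kR: "exp (real k + 1) \<le> R" "R \<le> exp (real k + 2)"
      using k R by (simp_all add: ln_ge_iff ln_le_cancel_iff[of R "exp _", symmetric] del: ln_le_cancel_iff)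
    have "R powr (-n) \<le> exp (real k + 1) powr (-n)"
      using kR n by (intro powr_mono2') auto
    moreover have "ln R powr (-p) \<le> real (Suc k) powr (-p)"
      using k p by (intro powr_mono2') auto
    ultimately have "ennreal (R powr (-n) * ln R powr (-p)) \<le> ?c k"
      by (intro ennreal_leI mult_mono) auto
    moreover have "x \<in> ?A k" using R kR by simp
    ultimately show "\<exists>k. x \<in> ?A k \<and>
        ennreal (shifted_norm x powr (-n) * ln (shifted_norm x) powr (-p)) \<le> ?c k"
      unfolding R_def by blast
  qed simp
  also have "\<dots> = (\<Sum>k. ennreal (V * exp n * real (Suc k) powr (-p)))"
  proof (rule suminf_cong)
    fix k :: nat
    have "emeasure lborel (?A k) = ennreal (V * exp (real k + 2) powr n)"
      by (simp add: emeasure_cball V_def n_def powr_realpow)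
    then have "?c k * emeasure lborel (?A k)
        = ennreal (exp (real k + 1) powr (-n) * real (Suc k) powr (-p) * (V * exp (real k + 2) powr n))"
      using V by (simp only: ennreal_mult'[symmetric] mult_nonneg_nonneg powr_ge_zero)
    also have "exp (real k + 1) powr (-n) * real (Suc k) powr (-p) * (V * exp (real k + 2) powr n)
        = V * (exp (real k + 1) powr (-n) * exp (real k + 2) powr n) * real (Suc k) powr (-p)"
      by (simp only: mult_ac)
    also have "exp (real k + 1) powr (-n) * exp (real k + 2) powr n = exp n"
      by (simp add: powr_def exp_add[symmetric] algebra_simps)
    finally show "?c k * emeasure lborel (?A k) = ennreal (V * exp n * real (Suc k) powr (-p))" .
  qed
  also have "\<dots> = ennreal (\<Sum>k. V * exp n * real (Suc k) powr (-p))"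
  proof (rule suminf_ennreal2)
    have "summable (\<lambda>k. real (Suc k) powr (-p))"
      using p by (subst summable_Suc_iff) (simp add: summable_real_powr_iff)
    then show "summable (\<lambda>k. V * exp n * real (Suc k) powr (-p))" by (rule summable_mult)
  qed (use V in simp)
  also have "\<dots> < \<infinity>" by simp
  finally show ?thesis by (simp add: n_def)
qed

lemma ennreal_powr_le:
  assumes "a \<le> ennreal b" "0 \<le> b" "0 < r"
  shows "ennreal_powr a r \<le> ennreal (b powr r)"
proof -
  have "a \<noteq> \<infinity>" using assms(1) by (metis ennreal_less_top infinity_ennreal_def leD)
  moreover have "enn2real a \<le> b" using assms by (metis enn2real_leI)
  ultimately show ?thesis
    using assms by (auto simp: ennreal_powr_def intro!: ennreal_leI powr_mono2)
qed

lemma slow_wave_in_W_dot: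
  fixes s p q :: real
  assumes p: "0 < p" and q: "0 < q" and s: "0 < s" "s < 1" and sp: "real CARD('n::finite) \<le> s * p"
  shows "(slow_wave :: real ^ 'n \<Rightarrow> real) \<in> W_dot s p q"
proof -
  define n where "n = real CARD('n)"
  have "1 < p"
  proof -
    have "1 \<le> n" by (simp add: n_def Suc_leI)
    also have "n \<le> s * p" using sp by (simp add: n_def)
    also have "s * p < p" using s p by simp
    finally show ?thesis .
  qed
  have dim: "DIM(real ^ 'n) = CARD('n)" by simp
  obtain C where C: "0 \<le> C" and inner: "\<And>x :: real ^ 'n.
      (\<integral>\<^sup>+ y. ennreal (\<bar>slow_wave x - slow_wave y\<bar> powr q / norm (x - y) powr (n + s * q)) \<partial>lborel)
        \<le> ennreal (C * (shifted_norm x powr (-s * q) * ln (shifted_norm x) powr (-q)))"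
    unfolding n_def by (fact slow_wave_inner_integral_le[OF q s, where 'a = "real ^ 'n", unfolded dim])
  have outer: "ennreal_powr
      (\<integral>\<^sup>+ y. ennreal (\<bar>slow_wave x - slow_wave y\<bar> powr q / norm (x - y) powr (n + s * q)) \<partial>lborel) (p / q)
      \<le> ennreal (C powr (p / q)) * ennreal (shifted_norm x powr (-n) * ln (shifted_norm x) powr (-p))"
    for x :: "real ^ 'n"
  proof -
    define R where "R = shifted_norm x"
    define L where "L = ln R"
    have R: "1 \<le> R" and L: "1 \<le> L"
      using shifted_norm_ge ln_shifted_norm_ge_1 by (auto simp: R_def L_def)
    have "ennreal_powr
      (\<integral>\<^sup>+ y. ennreal (\<bar>slow_wave x - slow_wave y\<bar> powr q / norm (x - y) powr (n + s * q)) \<partial>lborel) (p / q)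
      \<le> ennreal ((C * (R powr (-s * q) * L powr (-q))) powr (p / q))"
      unfolding R_def L_def using p q C by (intro ennreal_powr_le inner) auto
    also have "(C * (R powr (-s * q) * L powr (-q))) powr (p / q)
        = C powr (p / q) * (R powr (-(s * p)) * L powr (-p))"
      using C q by (simp add: powr_mult powr_powr)
    also have "\<dots> \<le> C powr (p / q) * (R powr (-n) * L powr (-p))"
      using R sp by (intro mult_left_mono mult_right_mono powr_mono) (auto simp: n_def)
    finally show ?thesis
      by (simp add: ennreal_mult R_def L_def ennreal_leI)
  qed
  have "(\<integral>\<^sup>+ x. ennreal_powr
      (\<integral>\<^sup>+ y. ennreal (\<bar>slow_wave x - slow_wave y\<bar> powr q / norm (x - y) powr (n + s * q)) \<partial>lborel) (p / q)
        \<partial>(lborel :: (real ^ 'n) measure))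
     \<le> (\<integral>\<^sup>+ x. ennreal (C powr (p / q)) * ennreal (shifted_norm x powr (-n) * ln (shifted_norm x) powr (-p))
        \<partial>(lborel :: (real ^ 'n) measure))"
    by (intro nn_integral_mono outer)
  also have "\<dots> = ennreal (C powr (p / q)) *
      (\<integral>\<^sup>+ x. ennreal (shifted_norm x powr (-n) * ln (shifted_norm x) powr (-p)) \<partial>(lborel :: (real ^ 'n) measure))"
    unfolding shifted_norm_def by (intro nn_integral_cmult) measurable
  also have "\<dots> < \<infinity>"
    using nn_integral_log_critical_power_finite[OF \<open>1 < p\<close>, where 'a = "real ^ 'n"]
    by (simp add: ennreal_mult_less_top n_def dim)
  finally have "(\<integral>\<^sup>+ x. ennreal_powr
      (\<integral>\<^sup>+ y. ennreal (\<bar>slow_wave x - slow_wave y\<bar> powr q / norm (x - y) powr (n + s * q)) \<partial>lborel) (p / q)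
        \<partial>(lborel :: (real ^ 'n) measure)) < \<infinity>" .
  moreover have "(slow_wave :: real ^ 'n \<Rightarrow> real) \<in> borel_measurable lborel"
    using borel_measurable_continuous_onI[OF continuous_on_slow_wave] by simp
  ultimately show ?thesis
    by (auto simp: W_dot_def nn_integral_completion n_def intro: measurable_completion)
qed

theorem proposition1p8:
  fixes s p q :: real
  assumes "CARD('n::finite) \<ge> 2"
    and "0 < p" and "0 < q"
    and "0 < s" and "s < 1"
    and "s * p \<ge> real CARD('n)"
  shows "\<exists>u :: real ^ 'n \<Rightarrow> real.
           bounded (range u) \<and> continuous_on UNIV u \<and> u \<in> W_dot s p q \<and>
           \<not> (\<exists>\<gamma> :: real \<Rightarrow> real ^ 'n.
                continuous_on {0..} \<gamma> \<and> \<gamma> 0 = 0 \<and> filterlim \<gamma> at_infinity at_top \<and>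
                (\<exists>L :: real. ((\<lambda>t. u (\<gamma> t)) \<longlongrightarrow> L) at_top))"
proof (intro exI[of _ slow_wave] conjI)
  show "bounded (range (slow_wave :: real ^ 'n \<Rightarrow> real))"
    by (intro boundedI[of _ 1]) (auto simp: slow_wave_def)
  show "continuous_on UNIV (slow_wave :: real ^ 'n \<Rightarrow> real)" by (rule continuous_on_slow_wave)
  show "(slow_wave :: real ^ 'n \<Rightarrow> real) \<in> W_dot s p q"
    using assms by (intro slow_wave_in_W_dot) auto
  show "\<not> (\<exists>\<gamma> :: real \<Rightarrow> real ^ 'n.
      continuous_on {0..} \<gamma> \<and> \<gamma> 0 = 0 \<and> filterlim \<gamma> at_infinity at_top \<and>
      (\<exists>L :: real. ((\<lambda>t. slow_wave (\<gamma> t)) \<longlongrightarrow> L) at_top))"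
    using slow_wave_no_limit_along_curve by blast
qed

end
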